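(* Let $n\ge 4$ be an even integer, let $\mathcal H_n$ be an $n$-dimensional complex Hilbert space with orthonormal basis $|0\rangle,\ldots,|n-1\rangle$, and let $\omega=e^{4\pi i/n}$. For $1\le m\le n/2-1$ and any integer $k$ put $$|\omega_{m,k}\rangle=\sum_{j=0}^{n/2-1}\omega^{jm}\,|\,(j+k) \bmod n\,\rangle\in\mathcal H_n .$$ Let $\mathbf{GenTiles1}$ be the set consisting of the following vectors of $\mathcal H_n\otimes\mathcal H_n$, each divided by its norm: $$|V_{mk}\rangle=|k\rangle\otimes|\omega_{m,k+1}\rangle,\qquad m=1,\ldots,n/2-1,\quad k=0,\ldots,n-1,$$ $$|H_{mk}\rangle=|\omega_{m,k}\rangle\otimes|k\rangle,\qquad m=1,\ldots,n/2-1,\quad k=0,\ldots,n-1,$$ $$|F\rangle=\sum_{i=0}^{n-1}\sum_{j=0}^{n-1}|i\rangle\otimes|j\rangle .$$ Then $\mathbf{GenTiles1}$ is an unextendible product basis of $\mathcal H_n\otimes\mathcal H_n$.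
   Context: A product state in $\mathcal H_A\otimes\mathcal H_B$ (with $\mathcal H_A,\mathcal H_B$ finite-dimensional complex Hilbert spaces) is a nonzero vector of the form $|\alpha\rangle\otimes|\beta\rangle$ with $|\alpha\rangle\in\mathcal H_A$, $|\beta\rangle\in\mathcal H_B$. A partial product basis of $\mathcal H=\mathcal H_A\otimes\mathcal H_B$ is a set $S$ of mutually orthonormal product states spanning a proper subspace $\mathcal H_S$ of $\mathcal H$. An unextendible product basis (UPB) is a partial product basis $S$ whose complementary subspace $\mathcal H_S^{\perp}$ (the orthogonal complement of $\mathcal H_S$ in $\mathcal H$) contains no product state. *)

theory Defs
  imports Complex_Main "Jordan_Normal_Form.VS_Connect"
begin

section \<open>Product states and unextendible product bases\<close>

text \<open>
  A Hilbert space of dimension \<open>d\<close> is \<^term>\<open>carrier_vec d :: complex vec set\<close> with inner product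
  \<^term>\<open>\<lambda>v w :: complex vec. v \<bullet>c w\<close>, which is conjugate-linear in the second argument.
  The tensor product of spaces of dimensions \<open>a\<close> and \<open>b\<close> is \<^term>\<open>carrier_vec (a * b) :: complex vec set\<close>,
  where coordinate \<open>i * b + j\<close> belongs to the basis vector \<open>|i> \<otimes> |j>\<close>.
\<close>

definition tensor_vec :: "complex vec \<Rightarrow> complex vec \<Rightarrow> complex vec" (infixl \<open>\<otimes>\<^sub>v\<close> 75) where
  "v \<otimes>\<^sub>v w = vec (dim_vec v * dim_vec w) (\<lambda>i. v $ (i div dim_vec w) * w $ (i mod dim_vec w))"

definition product_state :: "nat \<Rightarrow> nat \<Rightarrow> complex vec \<Rightarrow> bool" where
  "product_state a b v \<longleftrightarrow>
     v \<noteq> 0\<^sub>v (a * b) \<and> (\<exists>\<alpha> \<in> carrier_vec a. \<exists>\<beta> \<in> carrier_vec b. v = \<alpha> \<otimes>\<^sub>v \<beta>)"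

definition orthonormal_set :: "complex vec set \<Rightarrow> bool" where
  "orthonormal_set S \<longleftrightarrow> (\<forall>u \<in> S. \<forall>v \<in> S. u \<bullet>c v = (if u = v then 1 else 0))"

definition span_vec :: "nat \<Rightarrow> complex vec set \<Rightarrow> complex vec set" where
  "span_vec d S = LinearCombinations.module.span class_ring (module_vec TYPE(complex) d) S"

text \<open>The library's \<open>orthogonal_complement\<close> uses the bilinear product, not the Hermitian one.\<close>

definition hermitian_complement :: "nat \<Rightarrow> complex vec set \<Rightarrow> complex vec set" where
  "hermitian_complement d W = {v \<in> carrier_vec d. \<forall>w \<in> W. v \<bullet>c w = 0}"

definition partial_product_basis :: "nat \<Rightarrow> nat \<Rightarrow> complex vec set \<Rightarrow> bool" where
  "partial_product_basis a b S \<longleftrightarrow>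
     (\<forall>v \<in> S. product_state a b v) \<and> orthonormal_set S \<and>
     span_vec (a * b) S \<subset> carrier_vec (a * b)"

definition unextendible_product_basis :: "nat \<Rightarrow> nat \<Rightarrow> complex vec set \<Rightarrow> bool" where
  "unextendible_product_basis a b S \<longleftrightarrow>
     partial_product_basis a b S \<and>
     \<not> (\<exists>v \<in> hermitian_complement (a * b) (span_vec (a * b) S). product_state a b v)"

definition normalize_vec :: "complex vec \<Rightarrow> complex vec" where
  "normalize_vec v = complex_of_real (1 / sqrt (Re (v \<bullet>c v))) \<cdot>\<^sub>v v"

section \<open>The set GenTiles1\<close>

definition omega_vec :: "nat \<Rightarrow> nat \<Rightarrow> int \<Rightarrow> complex vec" where
  "omega_vec n m k =
     finsum_vec TYPE(complex) n
       (\<lambda>j. exp (4 * complex_of_real pi * \<i> / of_nat n) ^ (j * m)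
              \<cdot>\<^sub>v unit_vec n (nat ((int j + k) mod int n)))
       {0..n div 2 - 1}"

definition V_vec :: "nat \<Rightarrow> nat \<Rightarrow> nat \<Rightarrow> complex vec" where
  "V_vec n m k = unit_vec n k \<otimes>\<^sub>v omega_vec n m (int k + 1)"

definition H_vec :: "nat \<Rightarrow> nat \<Rightarrow> nat \<Rightarrow> complex vec" where
  "H_vec n m k = omega_vec n m (int k) \<otimes>\<^sub>v unit_vec n k"

definition F_vec :: "nat \<Rightarrow> complex vec" where
  "F_vec n =
     finsum_vec TYPE(complex) (n * n) (\<lambda>(i, j). unit_vec n i \<otimes>\<^sub>v unit_vec n j)
       ({0..n - 1} \<times> {0..n - 1})"

definition GenTiles1 :: "nat \<Rightarrow> complex vec set" where
  "GenTiles1 n =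
     {normalize_vec (V_vec n m k) | m k. m \<in> {1..n div 2 - 1} \<and> k \<in> {0..n - 1}} \<union>
     {normalize_vec (H_vec n m k) | m k. m \<in> {1..n div 2 - 1} \<and> k \<in> {0..n - 1}} \<union>
     {normalize_vec (F_vec n)}"

end

theory Submission
  imports Defs
begin

text \<open>
  Write \<open>n = 2h\<close>. The states \<open>V\<close> and \<open>H\<close> live on the \<open>1 \<times> h\<close> and \<open>h \<times> 1\<close> tiles of a tiling of the
  cyclic \<open>n \<times> n\<close> grid; on each tile they are the nontrivial characters of \<open>\<int>/h\<close>. Hence a product
  vector \<open>\<alpha> \<otimes> \<beta>\<close> orthogonal to all of them is constant on every tile: if \<open>\<alpha>\<^sub>k \<noteq> 0\<close> then \<open>\<beta>\<close> is constant
  on \<open>k+1, \<dots>, k+h\<close>, and if \<open>\<beta>\<^sub>k \<noteq> 0\<close> then \<open>\<alpha>\<close> is constant on \<open>k, \<dots>, k+h-1\<close> (indices mod \<open>n\<close>). Since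
  consecutive windows overlap, this forces \<open>\<alpha> \<otimes> \<beta>\<close> to be a constant on the whole grid or on a single
  tile and zero elsewhere, so it is not orthogonal to \<open>F\<close>.
\<close>

section \<open>Periodic functions on the tiling\<close>

text \<open>Translation by \<open>k\<close> permutes the residues mod \<open>p\<close>. This allows
  a chosen index to be moved to the origin without changing the sum over a period.\<close>

lemma sum_periodic_shift:
  fixes f :: "int \<Rightarrow> 'a::comm_monoid_add"
  assumes p: "\<And>i. f (i mod p) = f i" and "p > 0"
  shows "(\<Sum>i\<in>{0..<p}. f (i + k)) = sum f {0..<p}"
proof (rule sum.reindex_bij_witness[where j = "\<lambda>i. (i + k) mod p" and i = "\<lambda>i. (i - k) mod p"])
  fix a assume "a \<in> {0..<p}"
  then show "((a + k) mod p - k) mod p = a" "(a + k) mod p \<in> {0..<p}"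
    "f ((a + k) mod p) = f (a + k)" "((a - k) mod p + k) mod p = a" "(a - k) mod p \<in> {0..<p}"
    using \<open>p > 0\<close> p by (auto simp: mod_simps)
qed

text \<open>If \<open>A 1 \<noteq> 0\<close>, both functions are constant; otherwise \<open>A\<close> is supported on
  \<open>0\<close> and \<open>B\<close> is constant on \<open>{1..h}\<close> and zero elsewhere.\<close>

lemma tile_functions_from_zero:
  fixes A B :: "int \<Rightarrow> 'a::{field_char_0}" and h :: int
  assumes h: "h \<ge> 2"
    and pA: "\<And>i. A (i mod (2*h)) = A i" and pB: "\<And>i. B (i mod (2*h)) = B i"
    and cA: "\<And>k j. A k \<noteq> 0 \<Longrightarrow> k < j \<Longrightarrow> j \<le> k + h \<Longrightarrow> B j = B (k + 1)"
    and cB: "\<And>k j. B k \<noteq> 0 \<Longrightarrow> k \<le> j \<Longrightarrow> j < k + h \<Longrightarrow> A j = A k"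
    and A0: "A 0 \<noteq> 0" and B1: "B 1 \<noteq> 0"
  shows "sum A {0..<2*h} \<noteq> 0 \<and> sum B {0..<2*h} \<noteq> 0"
proof -
  have B: "B j = B 1" if "0 < j" "j \<le> h" for j
    using cA[OF A0, of j] that by simp
  have "B h \<noteq> 0"
    using B[of h] B1 h by simp
  \<comment> \<open>Both \<open>B 1\<close> and \<open>B h\<close> are nonzero, so \<open>A\<close>
    is constant on {1..h} and on {h..2h-1}. The two windows share \<open>h\<close> and miss only the
    residue 0.\<close>
  have A1: "A j = A 1" if "1 \<le> j" "j < 2*h" for j
  proof (cases "j \<le> h")
    case True
    then show ?thesis
      using cB[OF B1, of j] that by simp
  next
    case False
    then have "A j = A h" "A h = A 1"
      using cB[OF \<open>B h \<noteq> 0\<close>, of j] cB[OF B1, of h] that h by auto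
    then show ?thesis by simp
  qed
  have A2h: "A (2*h) = A 0" "A (2*h+1) = A 1"
    using pA[of "2*h"] pA[of "2*h+1"] h pA[of 1] by (auto simp: mod_simps)
  have B2h: "B (2*h) = B 0"
    using pB[of "2*h"] by simp
  show ?thesis
  proof (cases "A 1 = 0")
    case False
    have "A h = A 1"
      using A1[of h] h by simp
    \<comment> \<open>Since \<open>A h\<close> is nonzero, \<open>B\<close> is constant on
      {h+1..2h}. The window opened by \<open>A 1\<close> is {2..h+1}; it links this half to the
      first one, which contains 2 because \<open>h\<close> is at least 2.\<close>
    have B': "B j = B 1" if "0 < j" "j \<le> 2*h" for j
    proof (cases "j \<le> h")
      case True
      then show ?thesis using B[of j] that by simp
    next
      case f: False
      have "B j = B (h+1)"
        using cA[of h j] f that False \<open>A h = A 1\<close> by simp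
      also have "\<dots> = B 2"
        using cA[of 1 "h+1"] False h by simp
      finally show ?thesis
        using B[of 2] h by simp
    qed
    have B0: "B 0 = B 1"
      using B'[of "2*h"] B2h h by simp
    \<comment> \<open>Now \<open>B 0\<close> is nonzero as well, and its window {0..h-1} contains 1,
      the step across the one residue still missing.\<close>
    have "A 0 = A 1"
      using cB[of 0 1] B0 B1 h by simp
    have "sum A {0..<2*h} = (\<Sum>i\<in>{0..<2*h}. A 0)"
    proof (rule sum.cong[OF refl])
      fix x assume "x \<in> {0..<2*h}"
      then show "A x = A 0"
        using A1[of x] \<open>A 0 = A 1\<close> by (cases "x = 0") auto
    qed
    moreover have "sum B {0..<2*h} = (\<Sum>i\<in>{0..<2*h}. B 1)"
    proof (rule sum.cong[OF refl])
      fix x assume "x \<in> {0..<2*h}"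
      then show "B x = B 1"
        using B'[of x] B0 by (cases "x = 0") auto
    qed
    ultimately show ?thesis
      using A0 B1 h by simp
  next
    case True
    \<comment> \<open>A nonzero \<open>B j\<close> would make \<open>A\<close> constant on
      {j..j+h-1}. This window contains \<open>2*h\<close>, where \<open>A\<close> equals
      \<open>A 0\<close>, and also an index where \<open>A\<close> equals \<open>A 1 = 0\<close>:
      the next one if \<open>j = 2*h\<close>, and \<open>j\<close> itself otherwise.\<close>
    have B': "B j = 0" if "h < j" "j \<le> 2*h" for j
    proof (rule ccontr)
      assume nz: "B j \<noteq> 0"
      show False
      proof (cases "j = 2*h")
        case t: True
        have "A (2*h+1) = A (2*h)"
          using cB[OF nz, of "2*h+1"] h t by simp
        then show False using A2h A0 True by simp
      next
        case False
        have "A (2*h) = A j"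
          using cB[OF nz, of "2*h"] that False by simp
        then show False
          using A1[of j] False that A2h A0 True h by simp
      qed
    qed
    have "sum A {0..<2*h} = sum A {0}"
      by (rule sum.mono_neutral_right) (use A1 True h in auto)
    moreover have "sum B {0..<2*h} = sum B {1..h}"
    proof (rule sum.mono_neutral_right)
      show "\<forall>i\<in>{0..<2*h} - {1..h}. B i = 0"
      proof
        fix i assume i: "i \<in> {0..<2*h} - {1..h}"
        show "B i = 0"
          using B'[of i] B'[of "2*h"] B2h i h by (cases "i = 0") auto
      qed
    qed (use h in auto)
    moreover have "sum B {1..h} = (\<Sum>i\<in>{1..h}. B 1)"
      by (intro sum.cong refl B) auto
    ultimately show ?thesis
      using A0 B1 h by simp
  qed
qed

text \<open>The constancy conditions are invariant under simultaneous translation of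
  \<open>A\<close> and \<open>B\<close>, so \<open>k\<close> may be taken to be 0.\<close>

lemma tile_functions_adjacent:
  fixes A B :: "int \<Rightarrow> 'a::{field_char_0}" and h :: int
  assumes h: "h \<ge> 2"
    and pA: "\<And>i. A (i mod (2*h)) = A i" and pB: "\<And>i. B (i mod (2*h)) = B i"
    and cA: "\<And>k j. A k \<noteq> 0 \<Longrightarrow> k < j \<Longrightarrow> j \<le> k + h \<Longrightarrow> B j = B (k + 1)"
    and cB: "\<And>k j. B k \<noteq> 0 \<Longrightarrow> k \<le> j \<Longrightarrow> j < k + h \<Longrightarrow> A j = A k"
    and Ak: "A k \<noteq> 0" and Bk: "B (k + 1) \<noteq> 0"
  shows "sum A {0..<2*h} \<noteq> 0 \<and> sum B {0..<2*h} \<noteq> 0"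
proof -
  have "(\<Sum>i\<in>{0..<2*h}. A (i + k)) \<noteq> 0 \<and> (\<Sum>i\<in>{0..<2*h}. B (i + k)) \<noteq> 0"
  proof (rule tile_functions_from_zero[OF h])
    show "A (i mod (2*h) + k) = A (i + k)" for i
      by (metis pA mod_add_left_eq)
    show "B (i mod (2*h) + k) = B (i + k)" for i
      by (metis pB mod_add_left_eq)
    show "B (j + k) = B (l + 1 + k)" if "A (l + k) \<noteq> 0" "l < j" "j \<le> l + h" for l j
      using cA[of "l + k" "j + k"] that by (simp add: algebra_simps)
    show "A (j + k) = A (l + k)" if "B (l + k) \<noteq> 0" "l \<le> j" "j < l + h" for l j
      using cB[of "l + k" "j + k"] that by (simp add: algebra_simps)
  qed (use Ak Bk in \<open>auto simp: add.commute\<close>)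
  then show ?thesis
    using sum_periodic_shift[where f = A and p = "2*h"] sum_periodic_shift[where f = B and p = "2*h"]
      pA pB h by simp
qed

text \<open>Arbitrary nonzero entries are reduced to an adjacent pair. If \<open>B (k + 1)\<close>
  vanishes, some nonzero \<open>B j\<close> has \<open>k\<close> in its window, which gives
  \<open>A j\<close> nonzero; then \<open>B j\<close>, \<open>A j\<close> is an adjacent pair once
  the two functions exchange roles.\<close>

lemma tile_functions_sum_nonzero:
  fixes A B :: "int \<Rightarrow> 'a::{field_char_0}" and h :: int
  assumes h: "h \<ge> 2"
    and pA: "\<And>i. A (i mod (2*h)) = A i" and pB: "\<And>i. B (i mod (2*h)) = B i"
    and cA: "\<And>k j. A k \<noteq> 0 \<Longrightarrow> k < j \<Longrightarrow> j \<le> k + h \<Longrightarrow> B j = B (k + 1)"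
    and cB: "\<And>k j. B k \<noteq> 0 \<Longrightarrow> k \<le> j \<Longrightarrow> j < k + h \<Longrightarrow> A j = A k"
    and Ak: "A k \<noteq> 0" and Bl: "B l \<noteq> 0"
  shows "sum A {0..<2*h} \<noteq> 0 \<and> sum B {0..<2*h} \<noteq> 0"
proof (cases "B (k + 1) = 0")
  case False
  show ?thesis
    by (rule tile_functions_adjacent[OF h pA pB cA cB Ak False])
next
  case True
  \<comment> \<open>The representative of \<open>l\<close> mod \<open>2*h\<close> in the period
    ending at \<open>k\<close>.\<close>
  define j where "j = k - ((k - l) mod (2*h))"
  have j: "j \<le> k" "k - 2*h < j"
    using h by (auto simp: j_def)
  have "j mod (2*h) = l mod (2*h)"
    unfolding j_def by (simp add: mod_simps)
  then have Bj: "B j \<noteq> 0"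
    using pB[of j] pB[of l] Bl by metis
  have "k < j + h"
  proof (rule ccontr)
    assume *: "\<not> k < j + h"
    \<comment> \<open>If \<open>j\<close> were at most \<open>k - h\<close>, its translate by one
      period would fall in the window {k+1..k+h} on which \<open>A k\<close> forces \<open>B\<close>
      to be constant.\<close>
    have "B (j + 2*h) = B (k + 1)"
      using cA[OF Ak, of "j + 2*h"] j * by simp
    moreover have "B (j + 2*h) = B j"
      using pB[of "j + 2*h"] pB[of j] by simp
    ultimately show False using Bj True by simp
  qed
  then have "A j \<noteq> 0"
    using cB[OF Bj, of k] j Ak by simp
  \<comment> \<open>The hypotheses are invariant under \<open>(A, B) \<mapsto> (B, A (\<cdot> - 1))\<close>.\<close>
  let ?A = "\<lambda>i. A (i - 1)"
  have pA': "?A (i mod (2*h)) = ?A i" for i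
    by (metis pA mod_diff_left_eq)
  have "sum B {0..<2*h} \<noteq> 0 \<and> sum ?A {0..<2*h} \<noteq> 0"
  proof (rule tile_functions_adjacent[where k = j and h = h and A = B and B = ?A])
    show "2 \<le> h" by (fact h)
    show "B (i mod (2*h)) = B i" "?A (i mod (2*h)) = ?A i" for i by (fact pB pA')+
    show "A (i - 1) = A (m + 1 - 1)" if "B m \<noteq> 0" "m < i" "i \<le> m + h" for m i
      using cB[of m "i - 1"] that by simp
    show "B i = B m" if "A (m - 1) \<noteq> 0" "m \<le> i" "i < m + h" for m i
      using cA[of "m - 1" i] that by simp
    show "B j \<noteq> 0" "A (j + 1 - 1) \<noteq> 0"
      using Bj \<open>A j \<noteq> 0\<close> by auto
  qed
  moreover have "(\<Sum>i\<in>{0..<2*h}. A (i - 1)) = sum A {0..<2*h}"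
    using sum_periodic_shift[where f = A and p = "2*h" and k = "-1"] pA h by simp
  ultimately show ?thesis by simp
qed

section \<open>Tensor products and inner products\<close>

lemma tensor_carrier [simp]:
  "a \<in> carrier_vec p \<Longrightarrow> b \<in> carrier_vec q \<Longrightarrow> a \<otimes>\<^sub>v b \<in> carrier_vec (p * q)"
  by (auto simp: tensor_vec_def)

lemma sum_div_mod:
  fixes f :: "nat \<Rightarrow> nat \<Rightarrow> 'a::comm_monoid_add"
  shows "(\<Sum>i<p*q. f (i div q) (i mod q)) = (\<Sum>a<p. \<Sum>b<q. f a b)"
proof -
  have "(\<Sum>i<p*q. f (i div q) (i mod q)) = (\<Sum>(a,b)\<in>{..<p}\<times>{..<q}. f a b)"
  proof (rule sum.reindex_bij_witness[where j = "\<lambda>i. (i div q, i mod q)" and i = "\<lambda>(a,b). a * q + b"])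
    fix c assume "c \<in> {..<p} \<times> {..<q}"
    then obtain a b where c: "c = (a, b)" "a < p" "b < q" by auto
    have "a * q + b < Suc a * q" using c by simp
    also have "\<dots> \<le> p * q" using c by (intro mult_le_mono1) simp
    finally show "(case c of (a, b) \<Rightarrow> a * q + b) \<in> {..<p * q}" using c by simp
    show "((case c of (a, b) \<Rightarrow> a * q + b) div q, (case c of (a, b) \<Rightarrow> a * q + b) mod q) = c"
      using c by simp
  next
    fix i assume i: "i \<in> {..<p * q}"
    then have "q > 0" by (cases "q = 0") auto
    then show "(i div q, i mod q) \<in> {..<p} \<times> {..<q}"
      using i by (auto simp: less_mult_imp_div_less)
  qed auto
  then show ?thesis by (simp add: sum.cartesian_product)
qed

lemma cscalar_prod_sum:
  fixes v w :: "complex vec"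
  assumes "dim_vec w = n"
  shows "v \<bullet>c w = (\<Sum>i<n. v $ i * cnj (w $ i))"
  using assms by (simp add: scalar_prod_def lessThan_atLeast0)

lemma cscalar_tensor:
  assumes "a \<in> carrier_vec p" "c \<in> carrier_vec p" "b \<in> carrier_vec q" "d \<in> carrier_vec q"
  shows "(a \<otimes>\<^sub>v b) \<bullet>c (c \<otimes>\<^sub>v d) = (a \<bullet>c c) * (b \<bullet>c d)"
proof -
  have "(a \<otimes>\<^sub>v b) \<bullet>c (c \<otimes>\<^sub>v d)
      = (\<Sum>i<p*q. (a $ (i div q) * b $ (i mod q)) * cnj (c $ (i div q) * d $ (i mod q)))"
    using assms by (subst cscalar_prod_sum[where n = "p*q"]) (auto simp: tensor_vec_def)
  also have "\<dots> = (\<Sum>i<p. \<Sum>j<q. (a $ i * b $ j) * cnj (c $ i * d $ j))"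
    by (rule sum_div_mod)
  also have "\<dots> = (\<Sum>i<p. a $ i * cnj (c $ i)) * (\<Sum>j<q. b $ j * cnj (d $ j))"
    by (simp add: sum_product algebra_simps)
  also have "\<dots> = (a \<bullet>c c) * (b \<bullet>c d)"
    using assms by (simp add: cscalar_prod_sum)
  finally show ?thesis .
qed

lemma cscalar_sym:
  fixes v w :: "complex vec"
  assumes "v \<in> carrier_vec n" "w \<in> carrier_vec n"
  shows "w \<bullet>c v = cnj (v \<bullet>c w)"
  using assms by (simp add: cscalar_prod_sum mult.commute)

lemma cscalar_unit_right:
  fixes v :: "complex vec"
  assumes "i < n"
  shows "v \<bullet>c unit_vec n i = v $ i"
proof -
  have "conjugate (unit_vec n i :: complex vec) = unit_vec n i"
    by (intro eq_vecI) (auto simp: unit_vec_def)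
  then show ?thesis using assms by simp
qed

section \<open>Roots of unity\<close>

text \<open>Orthogonality of the characters of Z/h: for distinct \<open>a\<close>, \<open>b\<close>
  the ratio \<open>r\<close> is an h-th root of unity other than 1, so its geometric sum
  vanishes.\<close>

lemma sum_root_unity:
  fixes h a b :: nat
  defines "z \<equiv> cis (2 * pi / h)"
  assumes "a < h" "b < h"
  shows "(\<Sum>m<h. z ^ (a * m) * cnj z ^ (b * m)) = (if a = b then of_nat h else 0)"
proof (cases "a = b")
  case True
  have "z * cnj z = 1"
    by (simp add: z_def cis_cnj cis_mult)
  then have "z ^ k * cnj z ^ k = 1" for k
    by (metis power_mult_distrib power_one)
  then show ?thesis using True by simp
next
  case False
  define r where "r = z ^ a * cnj z ^ b"
  have zz: "z * cnj z = 1"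
    by (simp add: z_def cis_cnj cis_mult)
  have zh: "z ^ h = 1"
    using assms by (simp add: z_def DeMoivre)
  have "r ^ h = (z ^ h) ^ a * cnj (z ^ h) ^ b"
    by (simp add: r_def power_mult_distrib mult.commute flip: power_mult)
  then have rh: "r ^ h = 1" using zh by simp
  have "r \<noteq> 1"
  proof
    assume "r = 1"
    then have "z ^ a * (cnj z ^ b * z ^ b) = z ^ b"
      by (simp add: r_def flip: mult.assoc)
    then have "z ^ a = z ^ b"
      using zz by (metis power_mult_distrib power_one mult.commute mult_1)
    \<comment> \<open>Primitivity of \<open>z\<close>: its powers with exponents below
      \<open>h\<close> are pairwise distinct.\<close>
    moreover have "inj_on (\<lambda>k. cis (2 * pi * real k / real h)) {..<h}"
      using bij_betw_roots_unity[of h] assms by (auto simp: bij_betw_def)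
    moreover have "z ^ k = cis (2 * pi * real k / real h)" for k
      by (simp add: z_def DeMoivre mult.commute)
    ultimately show False
      using False assms by (auto simp: inj_on_def)
  qed
  have "(\<Sum>m<h. z ^ (a * m) * cnj z ^ (b * m)) = (\<Sum>m<h. r ^ m)"
    by (simp add: r_def power_mult power_mult_distrib)
  also have "\<dots> = 0"
    using \<open>r \<noteq> 1\<close> rh by (simp add: geometric_sum)
  finally show ?thesis using False by simp
qed

text \<open>Fourier inversion on Z/h: when all nontrivial coefficients vanish, only the term
  \<open>m = 0\<close> survives, and \<open>h\<close> times every value equals the total
  sum.\<close>

lemma fourier_orthogonal_imp_constant:
  fixes f :: "nat \<Rightarrow> complex" and h :: nat
  assumes orth: "\<And>m. 1 \<le> m \<Longrightarrow> m < h \<Longrightarrow> (\<Sum>j<h. f j * cnj (cis (2 * pi / h)) ^ (j * m)) = 0"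
    and "i < h" "j < h"
  shows "f i = f j"
proof -
  define z where "z = cis (2 * pi / h)"
  have inv: "of_nat h * f i = sum f {..<h}" if i: "i < h" for i
  proof -
    have "of_nat h * f i = (\<Sum>l<h. if i = l then of_nat h * f l else 0)"
      using i by simp
    also have "\<dots> = (\<Sum>l<h. f l * (\<Sum>m<h. z ^ (i * m) * cnj z ^ (l * m)))"
      using i by (intro sum.cong) (auto simp: z_def sum_root_unity)
    also have "\<dots> = (\<Sum>m<h. z ^ (i * m) * (\<Sum>l<h. f l * cnj z ^ (l * m)))"
      unfolding sum_distrib_left by (subst sum.swap) (simp add: algebra_simps)
    also have "\<dots> = (\<Sum>m\<in>{0}. z ^ (i * m) * (\<Sum>l<h. f l * cnj z ^ (l * m)))"
      by (rule sum.mono_neutral_right) (use i orth in \<open>auto simp: z_def\<close>)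
    finally show ?thesis by simp
  qed
  show ?thesis
    using inv[of i] inv[of j] assms(2,3) by (metis mult_cancel_left of_nat_eq_0_iff not_less0)
qed

section \<open>Inner products of the tile states\<close>

lemma omega_vec_carrier [simp]:
  "omega_vec n m k \<in> carrier_vec n"
  unfolding omega_vec_def by (rule finsum_vec_closed) auto

lemma omega_vec_dim [simp]: "dim_vec (omega_vec n m k) = n"
  using omega_vec_carrier carrier_vecD by blast

text \<open>With \<open>n = 2h\<close> the root exp(4 pi i / n) becomes the primitive h-th root
  \<open>cis (2 * pi / h)\<close>, so the coefficients along a tile are characters of Z/h.\<close>

lemma omega_vec_index:
  assumes h: "h > 0" and i: "i < 2 * h"
  shows "omega_vec (2 * h) m k $ i =
    (\<Sum>j<h. if i = nat ((int j + k) mod int (2 * h)) then cis (2 * pi / h) ^ (j * m) else 0)"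
proof -
  have e: "exp (4 * complex_of_real pi * \<i> / of_nat (2 * h)) = cis (2 * pi / h)"
    by (simp add: cis_conv_exp field_simps)
  have s: "{0..2 * h div 2 - 1} = {..<h}" using h by auto
  show ?thesis
    unfolding omega_vec_def e s
    by (subst index_finsum_vec) (use i h in \<open>auto simp: nat_less_iff intro!: sum.cong\<close>)
qed

text \<open>The inner product is the \<open>m\<close>-th Fourier coefficient of \<open>v\<close>
  restricted to the cyclic window of length \<open>h\<close> starting at \<open>k\<close>.\<close>

lemma cscalar_omega_vec:
  assumes h: "h > 0"
  shows "v \<bullet>c omega_vec (2 * h) m k =
    (\<Sum>j<h. v $ nat ((int j + k) mod int (2 * h)) * cnj (cis (2 * pi / h)) ^ (j * m))"
proof -
  let ?p = "\<lambda>j. nat ((int j + k) mod int (2 * h))"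
  have p: "?p j < 2 * h" for j
    using h by (simp add: nat_less_iff)
  have "v \<bullet>c omega_vec (2 * h) m k = (\<Sum>i<2*h. v $ i * cnj (omega_vec (2 * h) m k $ i))"
    by (simp add: cscalar_prod_sum)
  also have "\<dots> = (\<Sum>i<2*h. \<Sum>j<h. if i = ?p j then v $ i * cnj (cis (2 * pi / h)) ^ (j * m) else 0)"
    by (intro sum.cong) (auto simp: omega_vec_index[OF h] sum_distrib_left intro!: sum.cong)
  also have "\<dots> = (\<Sum>j<h. \<Sum>i<2*h. if i = ?p j then v $ i * cnj (cis (2 * pi / h)) ^ (j * m) else 0)"
    by (rule sum.swap)
  also have "\<dots> = (\<Sum>j<h. v $ ?p j * cnj (cis (2 * pi / h)) ^ (j * m))"
    using p by (intro sum.cong) auto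
  finally show ?thesis .
qed

text \<open>Offsets below \<open>h\<close> remain distinct mod \<open>2 * h\<close>, so exactly one
  term of the defining sum reaches the given position.\<close>

lemma omega_vec_index_tile:
  assumes h: "h > 0" and l: "l < h"
  shows "omega_vec (2 * h) m k $ nat ((int l + k) mod int (2 * h)) = cis (2 * pi / h) ^ (l * m)"
proof -
  have eq: "nat ((int l + k) mod int (2 * h)) = nat ((int j + k) mod int (2 * h)) \<longleftrightarrow> j = l"
    if "j < h" for j
  proof
    assume "nat ((int l + k) mod int (2 * h)) = nat ((int j + k) mod int (2 * h))"
    then have "(int l + k) mod int (2 * h) = (int j + k) mod int (2 * h)"
      using h by (simp add: nat_eq_iff)
    then have "(int l + k - k) mod int (2 * h) = (int j + k - k) mod int (2 * h)"
      by (metis mod_diff_left_eq)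
    then have "int l mod int (2 * h) = int j mod int (2 * h)" by simp
    then show "j = l" using that l by simp
  qed simp
  have "nat ((int l + k) mod int (2 * h)) < 2 * h"
    using h by (simp add: nat_less_iff)
  then have "omega_vec (2 * h) m k $ nat ((int l + k) mod int (2 * h)) =
      (\<Sum>j<h. if j = l then cis (2 * pi / h) ^ (j * m) else 0)"
    unfolding omega_vec_index[OF h \<open>nat _ < 2 * h\<close>] by (intro sum.cong refl if_cong eq) auto
  then show ?thesis using l by simp
qed

text \<open>The cyclic offset of \<open>i\<close> from the start \<open>k\<close> decides membership
  in the window; offsets of at least \<open>h\<close> lie outside.\<close>

lemma omega_vec_index_zero:
  assumes h: "h > 0" and i: "i < 2 * h" and out: "(int i - k) mod int (2 * h) \<ge> int h"
  shows "omega_vec (2 * h) m k $ i = 0"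
proof -
  have "i \<noteq> nat ((int j + k) mod int (2 * h))" if "j < h" for j
  proof
    assume "i = nat ((int j + k) mod int (2 * h))"
    then have "int i = (int j + k) mod int (2 * h)" using h by simp
    then have "(int i - k) mod int (2 * h) = int j mod int (2 * h)"
      by (simp add: mod_simps)
    then show False using out that by simp
  qed
  then show ?thesis
    by (subst omega_vec_index[OF h i]) (auto intro!: sum.neutral)
qed

lemma cscalar_omega_omega:
  assumes "m < h" "m' < h"
  shows "omega_vec (2 * h) m k \<bullet>c omega_vec (2 * h) m' k = (if m = m' then of_nat h else 0)"
proof -
  have h: "h > 0" using assms by simp
  have "omega_vec (2 * h) m k \<bullet>c omega_vec (2 * h) m' k =
      (\<Sum>j<h. cis (2 * pi / h) ^ (m * j) * cnj (cis (2 * pi / h)) ^ (m' * j))"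
    unfolding cscalar_omega_vec[OF h]
    by (intro sum.cong refl) (simp add: omega_vec_index_tile[OF h] mult.commute[of _ m] mult.commute[of _ m'] del: of_nat_mult)
  then show ?thesis using sum_root_unity[OF assms] by simp
qed

text \<open>Factoring \<open>F_vec\<close> through all-ones vectors lets its inner products with
  product vectors split into sums over the two coordinates.\<close>

lemma F_vec_eq:
  assumes n: "n > 0"
  shows "F_vec n = vec n (\<lambda>_. 1) \<otimes>\<^sub>v vec n (\<lambda>_. 1)"
proof (rule eq_vecI)
  have "F_vec n \<in> carrier_vec (n * n)"
    unfolding F_vec_def by (rule finsum_vec_closed) auto
  then show "dim_vec (F_vec n) = dim_vec (vec n (\<lambda>_. 1) \<otimes>\<^sub>v vec n (\<lambda>_. 1))"
    by (auto simp: tensor_vec_def)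
  fix x assume "x < dim_vec (vec n (\<lambda>_. 1) \<otimes>\<^sub>v vec n (\<lambda>_. 1))"
  then have x: "x < n * n" by (simp add: tensor_vec_def)
  have d: "x div n < n" "x mod n < n" 
    using x n by (auto simp: less_mult_imp_div_less)
  then have "x mod n \<le> n - 1" "x div n \<le> n - 1" by linarith+
  note d = d this
  have "F_vec n $ x = (\<Sum>(i,j)\<in>{0..n-1}\<times>{0..n-1}. (unit_vec n i \<otimes>\<^sub>v unit_vec n j) $ x)"
    unfolding F_vec_def by (subst index_finsum_vec) (use x in \<open>auto intro!: sum.cong\<close>)
  also have "\<dots> = (\<Sum>(i,j)\<in>{0..n-1}\<times>{0..n-1}. if (i, j) = (x div n, x mod n) then 1 else 0)"
    using x d by (intro sum.cong) (auto simp: tensor_vec_def)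
  also have "\<dots> = (\<Sum>c\<in>{0..n-1}\<times>{0..n-1}. if c = (x div n, x mod n) then 1 else 0)"
    by (intro sum.cong refl) (simp split: prod.split)
  also have "\<dots> = 1"
    using d n by (subst sum.delta) auto
  finally show "F_vec n $ x = (vec n (\<lambda>_. 1) \<otimes>\<^sub>v vec n (\<lambda>_. 1)) $ x"
    using x d by (simp add: tensor_vec_def)
qed

text \<open>On a window the all-ones vector is the trivial character, hence the case
  \<open>a = 0\<close> of \<open>sum_root_unity\<close>.\<close>

lemma cscalar_one_omega:
  assumes "m < h"
  shows "vec (2 * h) (\<lambda>_. 1) \<bullet>c omega_vec (2 * h) m k = (if m = 0 then of_nat h else 0)"
proof -
  have h: "h > 0" using assms by simp
  have *: "nat ((int j + k) mod int (2 * h)) < 2 * h" for j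
    using h by (simp add: nat_less_iff)
  have "vec (2 * h) (\<lambda>_. 1) \<bullet>c omega_vec (2 * h) m k =
      (\<Sum>j<h. cis (2 * pi / h) ^ (0 * j) * cnj (cis (2 * pi / h)) ^ (m * j))"
    unfolding cscalar_omega_vec[OF h]
    by (intro sum.cong refl) (simp add: * mult.commute[of _ m] del: of_nat_mult)
  also have "\<dots> = (if 0 = m then of_nat h else 0)"
    using assms h by (intro sum_root_unity)
  finally show ?thesis by simp
qed

lemma V_vec_carrier [simp]: "V_vec n m k \<in> carrier_vec (n * n)"
  and H_vec_carrier [simp]: "H_vec n m k \<in> carrier_vec (n * n)"
  by (simp_all add: V_vec_def H_vec_def)

lemma F_vec_carrier [simp]: "F_vec n \<in> carrier_vec (n * n)"
  unfolding F_vec_def by (rule finsum_vec_closed) auto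

lemma cscalar_V_V:
  assumes "m < h" "m' < h" "k < 2 * h" "k' < 2 * h"
  shows "V_vec (2 * h) m k \<bullet>c V_vec (2 * h) m' k' = (if m = m' \<and> k = k' then of_nat h else 0)"
  using assms unfolding V_vec_def
  by (subst cscalar_tensor[of _ "2*h" _ _ "2*h"]) (auto simp: cscalar_unit_right cscalar_omega_omega)

lemma cscalar_H_H:
  assumes "m < h" "m' < h" "k < 2 * h" "k' < 2 * h"
  shows "H_vec (2 * h) m k \<bullet>c H_vec (2 * h) m' k' = (if m = m' \<and> k = k' then of_nat h else 0)"
  using assms unfolding H_vec_def
  by (subst cscalar_tensor[of _ "2*h" _ _ "2*h"]) (auto simp: cscalar_unit_right cscalar_omega_omega)

text \<open>Tiles of the two kinds are disjoint, and only the cell \<open>(k, k')\<close> could be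
  common. If \<open>r\<close> is its offset in the H tile, its offset in the V tile is
  \<open>2 * h - 1 - r\<close>, and \<open>r\<close> and \<open>2 * h - 1 - r\<close> cannot both be
  below \<open>h\<close>.\<close>

lemma cscalar_V_H:
  assumes h: "h > 0" and "k < 2 * h" "k' < 2 * h"
  shows "V_vec (2 * h) m k \<bullet>c H_vec (2 * h) m' k' = 0"
proof -
  have "V_vec (2 * h) m k \<bullet>c H_vec (2 * h) m' k' =
      cnj (omega_vec (2 * h) m' (int k') $ k) * omega_vec (2 * h) m (int k + 1) $ k'"
    unfolding V_vec_def H_vec_def
    by (subst cscalar_tensor[of _ "2*h" _ _ "2*h"])
      (use assms in \<open>auto simp: cscalar_unit_right\<close>)
  moreover have "omega_vec (2 * h) m' (int k') $ k = 0 \<or> omega_vec (2 * h) m (int k + 1) $ k' = 0"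
  proof (cases "(int k - int k') mod int (2 * h) \<ge> int h")
    case True
    then show ?thesis using omega_vec_index_zero[OF h] assms by blast
  next
    case False
    define r where "r = (int k - int k') mod int (2 * h)"
    have r: "0 \<le> r" "r < int h"
      unfolding r_def using h False by (intro pos_mod_sign, auto)
    have "(int k' - (int k + 1)) mod int (2 * h) = (- 1 - r) mod int (2 * h)"
      unfolding r_def by (simp add: mod_simps algebra_simps)
    also have "\<dots> = (2 * int h - 1 - r) mod int (2 * h)"
      by (metis (no_types, lifting) add.commute add_diff_eq mod_add_self2 of_nat_mult of_nat_numeral uminus_add_conv_diff)
    also have "\<dots> = 2 * int h - 1 - r"
      using r h by (intro mod_pos_pos_trivial) auto
    finally have "(int k' - (int k + 1)) mod int (2 * h) \<ge> int h"
      using r by simp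
    then show ?thesis using omega_vec_index_zero[OF h] assms by blast
  qed
  ultimately show ?thesis by auto
qed

lemma cscalar_F_V:
  assumes "m < h" "k < 2 * h"
  shows "F_vec (2 * h) \<bullet>c V_vec (2 * h) m k = (if m = 0 then of_nat h else 0)"
  using assms unfolding V_vec_def
  by (subst F_vec_eq, simp, subst cscalar_tensor[of _ "2*h" _ _ "2*h"])
    (auto simp: cscalar_unit_right cscalar_one_omega)

lemma cscalar_F_H:
  assumes "m < h" "k < 2 * h"
  shows "F_vec (2 * h) \<bullet>c H_vec (2 * h) m k = (if m = 0 then of_nat h else 0)"
  using assms unfolding H_vec_def
  by (subst F_vec_eq, simp, subst cscalar_tensor[of _ "2*h" _ _ "2*h"])
    (auto simp: cscalar_unit_right cscalar_one_omega)

section \<open>Normalization and spans\<close>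

lemma normalize_vec_carrier [simp]: "v \<in> carrier_vec d \<Longrightarrow> normalize_vec v \<in> carrier_vec d"
  by (simp add: normalize_vec_def)

lemma cscalar_normalize_right:
  assumes "v \<in> carrier_vec d" "w \<in> carrier_vec d"
  shows "w \<bullet>c normalize_vec v = complex_of_real (1 / sqrt (Re (v \<bullet>c v))) * (w \<bullet>c v)"
proof -
  define c where "c = 1 / sqrt (Re (v \<bullet>c v))"
  then have "normalize_vec v = complex_of_real c \<cdot>\<^sub>v v" by (simp add: normalize_vec_def)
  then show ?thesis
    unfolding c_def[symmetric] using assms
    by (simp add: cscalar_prod_sum sum_distrib_left mult_ac)
qed

lemma cscalar_normalize_left:
  assumes "v \<in> carrier_vec d" "w \<in> carrier_vec d"
  shows "normalize_vec v \<bullet>c w = complex_of_real (1 / sqrt (Re (v \<bullet>c v))) * (v \<bullet>c w)"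
proof -
  define c where "c = 1 / sqrt (Re (v \<bullet>c v))"
  then have "normalize_vec v = complex_of_real c \<cdot>\<^sub>v v" by (simp add: normalize_vec_def)
  then show ?thesis
    unfolding c_def[symmetric] using assms
    by (simp add: cscalar_prod_sum sum_distrib_left mult_ac)
qed

lemma cscalar_normalize_self:
  assumes "v \<in> carrier_vec d" "v \<bullet>c v = complex_of_real r" "r > 0"
  shows "normalize_vec v \<bullet>c normalize_vec v = 1"
proof -
  have "normalize_vec v \<bullet>c normalize_vec v = complex_of_real (1 / sqrt r * (1 / sqrt r) * r)"
    unfolding of_real_mult using assms(2) by (simp add: cscalar_normalize_left[OF assms(1) normalize_vec_carrier[OF assms(1)]]
        cscalar_normalize_right[OF assms(1) assms(1)])
  also have "1 / sqrt r * (1 / sqrt r) * r = 1"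
    using assms(3) by (simp add: field_simps del: of_real_mult)
  finally show ?thesis by simp
qed

lemma orthonormal_set_normalize:
  assumes "R \<subseteq> carrier_vec d"
    and self: "\<And>v. v \<in> R \<Longrightarrow> \<exists>r>0. v \<bullet>c v = complex_of_real r"
    and orth: "\<And>u v. u \<in> R \<Longrightarrow> v \<in> R \<Longrightarrow> u \<noteq> v \<Longrightarrow> u \<bullet>c v = 0"
  shows "orthonormal_set (normalize_vec ` R)"
proof -
  have "normalize_vec u \<bullet>c normalize_vec v = (if normalize_vec u = normalize_vec v then 1 else 0)"
    if "u \<in> R" "v \<in> R" for u v
  proof -
    have c: "u \<in> carrier_vec d" "v \<in> carrier_vec d" using that assms(1) by auto
    have one: "normalize_vec w \<bullet>c normalize_vec w = 1" if "w \<in> R" for w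
      using self[OF that] cscalar_normalize_self that assms(1) by blast
    show ?thesis
    proof (cases "u = v")
      case True
      then show ?thesis using one that by simp
    next
      case False
      then have "normalize_vec u \<bullet>c normalize_vec v = 0"
        using orth[OF that] c
        by (simp add: cscalar_normalize_left[where d = d] cscalar_normalize_right[where d = d])
      \<comment> \<open>Norm 1 against inner product 0 also shows that distinct orthogonal vectors
        cannot have the same normalization.\<close>
      then show ?thesis using one[OF that(1)] by auto
    qed
  qed
  then show ?thesis by (auto simp: orthonormal_set_def)
qed

text \<open>The normalizing scalar is absorbed into the first factor, and unit norm excludes the
  zero vector.\<close>

lemma product_state_normalize_tensor:
  assumes "a \<in> carrier_vec p" "b \<in> carrier_vec q"
    and "(a \<otimes>\<^sub>v b) \<bullet>c (a \<otimes>\<^sub>v b) = complex_of_real r" "r > 0"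
  shows "product_state p q (normalize_vec (a \<otimes>\<^sub>v b))"
proof -
  let ?v = "normalize_vec (a \<otimes>\<^sub>v b)"
  have "?v \<bullet>c ?v = 1"
    using cscalar_normalize_self[OF tensor_carrier[OF assms(1,2)] assms(3,4)] .
  then have "?v \<noteq> 0\<^sub>v (p * q)" by auto
  moreover have "?v = (complex_of_real (1 / sqrt (Re ((a \<otimes>\<^sub>v b) \<bullet>c (a \<otimes>\<^sub>v b)))) \<cdot>\<^sub>v a) \<otimes>\<^sub>v b"
    unfolding normalize_vec_def using assms(1,2)
    by (intro eq_vecI) (auto simp: tensor_vec_def less_mult_imp_div_less)
  ultimately show ?thesis
    unfolding product_state_def using assms(1,2) by (metis smult_carrier_vec)
qed

text \<open>The vectors orthogonal to \<open>x\<close> form a submodule, which contains the span as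
  soon as it contains \<open>S\<close>.\<close>

lemma span_vec_orthogonal:
  assumes S: "S \<subseteq> carrier_vec d" and x: "x \<in> carrier_vec d"
    and orth: "\<And>s. s \<in> S \<Longrightarrow> s \<bullet>c x = 0" and y: "y \<in> span_vec d S"
  shows "y \<bullet>c x = 0"
proof -
  interpret vec_space "TYPE(complex)" d .
  let ?N = "{v \<in> carrier_vec d. v \<bullet>c x = 0}"
  have "submodule class_ring ?N V"
    by (rule submodule.intro)
      (use x in \<open>auto simp: add_scalar_prod_distrib[of _ d] intro: module_axioms\<close>)
  then have "span S \<subseteq> ?N"
    by (rule span_is_subset[rotated]) (use S orth in auto)
  then show ?thesis using y by (auto simp: span_vec_def)
qed

lemma span_vec_superset:
  assumes "S \<subseteq> carrier_vec d" shows "S \<subseteq> span_vec d S"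
proof -
  interpret vec_space "TYPE(complex)" d .
  show ?thesis unfolding span_vec_def using assms by (intro in_own_span) auto
qed

lemma span_vec_carrier:
  assumes "S \<subseteq> carrier_vec d" shows "span_vec d S \<subseteq> carrier_vec d"
proof -
  interpret vec_space "TYPE(complex)" d .
  show ?thesis unfolding span_vec_def using span_is_subset2 assms by auto
qed

section \<open>Unextendibility\<close>

text \<open>The states before normalization: their inner products are 0, \<open>h\<close> or
  \<open>n * n\<close> when \<open>n = 2 * h\<close>, and orthogonality can be settled without
  square roots.\<close>

definition tile_vecs :: "nat \<Rightarrow> complex vec set" where
  "tile_vecs n =
     {V_vec n m k | m k. m \<in> {1..n div 2 - 1} \<and> k \<in> {0..n - 1}} \<union>
     {H_vec n m k | m k. m \<in> {1..n div 2 - 1} \<and> k \<in> {0..n - 1}} \<union>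
     {F_vec n}"

lemma GenTiles1_eq: "GenTiles1 n = normalize_vec ` tile_vecs n"
  unfolding GenTiles1_def tile_vecs_def by blast

lemma tile_vecs_carrier: "tile_vecs n \<subseteq> carrier_vec (n * n)"
  unfolding tile_vecs_def by auto

lemma GenTiles1_carrier: "GenTiles1 n \<subseteq> carrier_vec (n * n)"
  using tile_vecs_carrier[of n] by (auto simp: GenTiles1_eq)

lemma tile_vecs_cases:
  assumes "v \<in> tile_vecs (2 * h)" "h > 0"
  obtains (V) m k where "v = V_vec (2 * h) m k" "1 \<le> m" "m < h" "k < 2 * h"
  | (H) m k where "v = H_vec (2 * h) m k" "1 \<le> m" "m < h" "k < 2 * h"
  | (F) "v = F_vec (2 * h)"
proof -
  have "m < h" if "m \<in> {1..2 * h div 2 - 1}" for m :: nat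
    using that by auto
  moreover have "k < 2 * h" if "k \<in> {0..2 * h - 1}" for k
    using that assms(2) by auto
  ultimately show thesis
    using assms(1) V H F unfolding tile_vecs_def
    by (elim UnE CollectE exE conjE singletonE) (metis atLeastAtMost_iff)+
qed

lemma V_vec_in_tile_vecs: "1 \<le> m \<Longrightarrow> m < h \<Longrightarrow> k < 2 * h \<Longrightarrow> V_vec (2 * h) m k \<in> tile_vecs (2 * h)"
  and H_vec_in_tile_vecs: "1 \<le> m \<Longrightarrow> m < h \<Longrightarrow> k < 2 * h \<Longrightarrow> H_vec (2 * h) m k \<in> tile_vecs (2 * h)"
  and F_vec_in_tile_vecs: "F_vec n \<in> tile_vecs n"
proof -
  have "k \<in> {0..2 * h - 1}" if "k < 2 * h" for k using that by auto
  moreover have "m \<in> {1..2 * h div 2 - 1}" if "1 \<le> m" "m < h" for m using that by auto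
  ultimately show "1 \<le> m \<Longrightarrow> m < h \<Longrightarrow> k < 2 * h \<Longrightarrow> V_vec (2 * h) m k \<in> tile_vecs (2 * h)"
    "1 \<le> m \<Longrightarrow> m < h \<Longrightarrow> k < 2 * h \<Longrightarrow> H_vec (2 * h) m k \<in> tile_vecs (2 * h)"
    unfolding tile_vecs_def by blast+
qed (simp add: tile_vecs_def)

section \<open>Orthogonality and product form of the states\<close>

lemma cscalar_F_F:
  assumes "n > 0"
  shows "F_vec n \<bullet>c F_vec n = of_nat (n * n)"
proof -
  have "vec n (\<lambda>_. 1 :: complex) \<bullet>c vec n (\<lambda>_. 1) = of_nat n"
    by (simp add: cscalar_prod_sum)
  then show ?thesis
    using assms by (simp add: F_vec_eq cscalar_tensor[of _ n _ _ n])
qed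

lemma tile_vecs_orthogonal:
  assumes h: "h > 0" and u: "u \<in> tile_vecs (2 * h)" and v: "v \<in> tile_vecs (2 * h)" and "u \<noteq> v"
  shows "u \<bullet>c v = 0"
proof -
  \<comment> \<open>The mixed inner products are available in one order only; conjugate symmetry
    supplies the other.\<close>
  have sym: "w \<bullet>c x = 0" if "x \<bullet>c w = 0" "w \<in> tile_vecs (2 * h)" "x \<in> tile_vecs (2 * h)" for w x
    using cscalar_sym[of x _ w] that tile_vecs_carrier by fastforce
  show ?thesis
    using u h
  proof (cases rule: tile_vecs_cases)
    case U: (V m k)
    from v h show ?thesis
    proof (cases rule: tile_vecs_cases)
      case (V m' k')
      then show ?thesis using U \<open>u \<noteq> v\<close> by (auto simp: cscalar_V_V)
    next
      case (H m' k')
      then show ?thesis using U h by (simp add: cscalar_V_H)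
    next
      case F
      then have "v \<bullet>c u = 0" using U by (simp add: cscalar_F_V)
      then show ?thesis using sym u v by blast
    qed
  next
    case U: (H m k)
    from v h show ?thesis
    proof (cases rule: tile_vecs_cases)
      case (V m' k')
      then have "v \<bullet>c u = 0" using U h by (simp add: cscalar_V_H)
      then show ?thesis using sym u v by blast
    next
      case (H m' k')
      then show ?thesis using U \<open>u \<noteq> v\<close> by (auto simp: cscalar_H_H)
    next
      case F
      then have "v \<bullet>c u = 0" using U by (simp add: cscalar_F_H)
      then show ?thesis using sym u v by blast
    qed
  next
    case U: F
    from v h show ?thesis
      by (cases rule: tile_vecs_cases) (use U \<open>u \<noteq> v\<close> in \<open>auto simp: cscalar_F_V cscalar_F_H\<close>)
  qed
qed

lemma tile_vecs_product:
  assumes h: "h > 0" and "v \<in> tile_vecs (2 * h)"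
  obtains a b r where "a \<in> carrier_vec (2 * h)" "b \<in> carrier_vec (2 * h)" "v = a \<otimes>\<^sub>v b"
    "v \<bullet>c v = complex_of_real r" "r > 0"
  using assms(2,1)
proof (cases rule: tile_vecs_cases)
  case (V m k)
  then show ?thesis
    using that[of "unit_vec (2*h) k" "omega_vec (2*h) m (int k + 1)" "real h"] h
    by (simp add: cscalar_V_V flip: V_vec_def)
next
  case (H m k)
  then show ?thesis
    using that[of "omega_vec (2*h) m (int k)" "unit_vec (2*h) k" "real h"] h
    by (simp add: cscalar_H_H flip: H_vec_def)
next
  case F
  then show ?thesis
    using that[of "vec (2*h) (\<lambda>_. 1)" "vec (2*h) (\<lambda>_. 1)" "real (2*h * (2*h))"] h
    by (simp add: cscalar_F_F flip: F_vec_eq)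
qed

text \<open>Taking \<open>m = 0\<close> in \<^const>\<open>V_vec\<close> gives the indicator of a tile; the difference of two
  such indicators witnesses that the span is proper.\<close>

lemma tile_vecs_span_proper:
  assumes h: "h > 0"
  shows "span_vec (2 * h * (2 * h)) (GenTiles1 (2 * h)) \<subset> carrier_vec (2 * h * (2 * h))"
proof -
  let ?d = "2 * h * (2 * h)" and ?V = "V_vec (2 * h) 0"
  define x where "x = ?V 0 - ?V 1"
  have x: "x \<in> carrier_vec ?d" unfolding x_def by (intro minus_carrier_vec V_vec_carrier)
  have diff: "s \<bullet>c x = s \<bullet>c ?V 0 - s \<bullet>c ?V 1" if "s \<in> carrier_vec ?d" for s
    using that carrier_vecD[OF V_vec_carrier[of "2*h"]]
    by (simp add: x_def cscalar_prod_sum[of _ ?d] right_diff_distrib sum_subtractf)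
  have "s \<bullet>c x = 0" if "s \<in> tile_vecs (2 * h)" for s
  proof -
    have s: "s \<in> carrier_vec ?d" using that tile_vecs_carrier by blast
    have sym: "H_vec (2 * h) m k \<bullet>c ?V l = cnj (?V l \<bullet>c H_vec (2 * h) m k)" for m k l
      by (intro cscalar_sym[of _ ?d] V_vec_carrier H_vec_carrier)
    \<comment> \<open>V states carry nontrivial characters, H states live on disjoint tiles, and
      \<open>F_vec\<close> pairs to \<open>h\<close> with both indicators, so the difference
      cancels.\<close>
    from that h show ?thesis
      unfolding diff[OF s]
      by (cases rule: tile_vecs_cases)
        (use h in \<open>simp_all add: cscalar_V_V cscalar_V_H cscalar_F_V sym\<close>)
  qed
  then have "s \<bullet>c x = 0" if "s \<in> GenTiles1 (2 * h)" for s
    using that x tile_vecs_carrier[of "2*h"]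
    by (auto simp: GenTiles1_eq cscalar_normalize_left[of _ ?d])
  moreover have "x \<bullet>c x \<noteq> 0"
  proof -
    have "?V 0 \<bullet>c x = of_nat h"
      unfolding diff[OF V_vec_carrier] using h by (simp add: cscalar_V_V)
    moreover have "?V 0 \<bullet>c (0\<^sub>v ?d) = 0"
      by (metis conjugate_zero_vec scalar_prod_right_zero V_vec_carrier)
    ultimately have "x \<noteq> 0\<^sub>v ?d" using h by fastforce
    then show ?thesis using conjugate_square_eq_0_vec[OF x] by simp
  qed
  moreover note S = GenTiles1_carrier[of "2 * h"]
  ultimately have "x \<notin> span_vec ?d (GenTiles1 (2 * h))"
    using span_vec_orthogonal[OF S x] by blast
  then show ?thesis using x span_vec_carrier[OF S] by blast
qed

section \<open>Product vectors orthogonal to all states\<close>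

lemma sum_cyclic_extension:
  assumes "n > 0"
  shows "(\<Sum>i\<in>{0..<int n}. f (nat (i mod int n))) = sum f {..<n}"
  by (rule sum.reindex_bij_witness[where i = int and j = nat]) auto

text \<open>If both factors were nonzero, their periodic extensions \<open>A\<close> and
  \<open>B\<close> would satisfy the tile conditions, so both coordinate sums would be nonzero; yet
  their product is the inner product with \<open>F_vec\<close>.\<close>

lemma tensor_orthogonal_tile_vecs:
  assumes h: "h \<ge> 2" and a: "a \<in> carrier_vec (2 * h)" and b: "b \<in> carrier_vec (2 * h)"
    and orth: "\<And>s. s \<in> tile_vecs (2 * h) \<Longrightarrow> (a \<otimes>\<^sub>v b) \<bullet>c s = 0"
  shows "a = 0\<^sub>v (2 * h) \<or> b = 0\<^sub>v (2 * h)"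
proof (rule ccontr)
  assume "\<not> ?thesis"
  then obtain i j where i: "i < 2 * h" "a $ i \<noteq> 0" and j: "j < 2 * h" "b $ j \<noteq> 0"
    using a b by (metis carrier_vecD eq_vecI index_zero_vec)
  let ?n = "int (2 * h)"
  define A where "A l = a $ nat (l mod ?n)" for l
  define B where "B l = b $ nat (l mod ?n)" for l
  have pos: "nat (l mod ?n) < 2 * h" for l
    using h by (simp add: nat_less_iff)
  have res: "int (nat (k mod ?n)) = k mod ?n" for k
    using h by simp
  have cA: "B l = B (k + 1)" if "A k \<noteq> 0" "k < l" "l \<le> k + int h" for k l
  proof -
    let ?k = "nat (k mod ?n)"
    \<comment> \<open>States are indexed by residues, whereas \<open>k\<close> is any integer;
      reducing the start of a window mod \<open>2 * h\<close> does not change its positions.\<close>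
    have idx: "(int r + (int ?k + 1)) mod ?n = (int r + (k + 1)) mod ?n" for r
      using mod_add_left_eq[of k ?n "int r + 1"] unfolding res by (simp only: ac_simps)
    have "B (int r + (k + 1)) = B (int s + (k + 1))" if "r < h" "s < h" for r s
    proof (rule fourier_orthogonal_imp_constant[where f = "\<lambda>r. B (int r + (k + 1))", OF _ that])
      fix m assume m: "1 \<le> m" "m < h"
      have "0 = (a \<otimes>\<^sub>v b) \<bullet>c V_vec (2 * h) m ?k"
        using orth V_vec_in_tile_vecs[OF m pos] by simp
      \<comment> \<open>The inner product with a V state is \<open>A k\<close> times a Fourier
        coefficient of \<open>b\<close> on the window after \<open>k\<close>; a nonzero
        \<open>A k\<close> can be cancelled.\<close>
      also have "\<dots> = A k * (b \<bullet>c omega_vec (2 * h) m (int ?k + 1))"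
        unfolding V_vec_def A_def
        by (subst cscalar_tensor[OF a _ b]) (use pos in \<open>auto simp: cscalar_unit_right\<close>)
      finally have "b \<bullet>c omega_vec (2 * h) m (int ?k + 1) = 0"
        using \<open>A k \<noteq> 0\<close> by simp
      then show "(\<Sum>j<h. B (int j + (k + 1)) * cnj (cis (2 * pi / h)) ^ (j * m)) = 0"
        using h unfolding B_def by (subst (asm) cscalar_omega_vec) (auto simp only: idx)
    qed
    from this[of "nat (l - (k + 1))" 0] show ?thesis using that h by simp
  qed
  have cB: "A l = A k" if "B k \<noteq> 0" "k \<le> l" "l < k + int h" for k l
  proof -
    let ?k = "nat (k mod ?n)"
    have idx: "(int r + int ?k) mod ?n = (int r + k) mod ?n" for r
      unfolding res by (simp only: mod_add_right_eq)
    have "A (int r + k) = A (int s + k)" if "r < h" "s < h" for r s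
    proof (rule fourier_orthogonal_imp_constant[where f = "\<lambda>r. A (int r + k)", OF _ that])
      fix m assume m: "1 \<le> m" "m < h"
      have "0 = (a \<otimes>\<^sub>v b) \<bullet>c H_vec (2 * h) m ?k"
        using orth H_vec_in_tile_vecs[OF m pos] by simp
      also have "\<dots> = (a \<bullet>c omega_vec (2 * h) m (int ?k)) * B k"
        unfolding H_vec_def B_def
        by (subst cscalar_tensor[OF a _ b]) (use pos in \<open>auto simp: cscalar_unit_right\<close>)
      finally have "a \<bullet>c omega_vec (2 * h) m (int ?k) = 0"
        using \<open>B k \<noteq> 0\<close> by simp
      then show "(\<Sum>j<h. A (int j + k) * cnj (cis (2 * pi / h)) ^ (j * m)) = 0"
        using h unfolding A_def by (subst (asm) cscalar_omega_vec) (auto simp only: idx)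
    qed
    from this[of "nat (l - k)" 0] show ?thesis using that h by simp
  qed
  have "sum A {0..<2 * int h} \<noteq> 0 \<and> sum B {0..<2 * int h} \<noteq> 0"
  proof (rule tile_functions_sum_nonzero)
    show "A (int i) \<noteq> 0" "B (int j) \<noteq> 0"
      using i j by (simp_all add: A_def B_def)
    show "B l = B (k + 1)" if "A k \<noteq> 0" "k < l" "l \<le> k + int h" for k l
      using that by (rule cA)
    show "A l = A k" if "B k \<noteq> 0" "k \<le> l" "l < k + int h" for k l
      using that by (rule cB)
  qed (use h in \<open>simp_all add: A_def B_def\<close>)
  moreover have "sum A {0..<2 * int h} = sum (($) a) {..<2 * h}"
    using sum_cyclic_extension[of "2 * h" "($) a"] h by (simp add: A_def)
  moreover have "sum B {0..<2 * int h} = sum (($) b) {..<2 * h}"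
    using sum_cyclic_extension[of "2 * h" "($) b"] h by (simp add: B_def)
  moreover have "(a \<otimes>\<^sub>v b) \<bullet>c F_vec (2 * h) = sum (($) a) {..<2 * h} * sum (($) b) {..<2 * h}"
    using h by (simp add: F_vec_eq cscalar_tensor[OF a _ b] cscalar_prod_sum[of "vec (2*h) _" "2*h"])
  ultimately show False
    using orth[OF F_vec_in_tile_vecs] by simp
qed

theorem theorem1:
  fixes n :: nat
  assumes "n \<ge> 4" and "even n"
  shows "unextendible_product_basis n n (GenTiles1 n)"
proof -
  from assms obtain h where n: "n = 2 * h" and h: "h \<ge> 2" by (auto elim!: evenE)
  note S = GenTiles1_carrier[of n]
  have prod: "product_state n n v" if "v \<in> GenTiles1 n" for v
  proof -
    from that obtain w where w: "w \<in> tile_vecs (2 * h)" "v = normalize_vec w"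
      by (auto simp: GenTiles1_eq n)
    obtain a b r where "a \<in> carrier_vec (2 * h)" "b \<in> carrier_vec (2 * h)" "w = a \<otimes>\<^sub>v b"
      "w \<bullet>c w = complex_of_real r" "r > 0"
      using tile_vecs_product[OF _ w(1)] h by auto
    then show ?thesis
      using product_state_normalize_tensor w(2) n by metis
  qed
  have on: "orthonormal_set (GenTiles1 n)"
    unfolding GenTiles1_eq
  proof (rule orthonormal_set_normalize[OF tile_vecs_carrier])
    fix v assume "v \<in> tile_vecs n"
    then show "\<exists>r>0. v \<bullet>c v = complex_of_real r"
      using tile_vecs_product[of h v] h n by (metis gr0I not_numeral_le_zero)
  next
    fix u v assume "u \<in> tile_vecs n" "v \<in> tile_vecs n" "u \<noteq> v"
    then show "u \<bullet>c v = 0"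
      using tile_vecs_orthogonal[of h u v] h n by simp
  qed
  have "\<not> product_state n n v" if v: "v \<in> hermitian_complement (n * n) (span_vec (n * n) (GenTiles1 n))" for v
  proof
    assume "product_state n n v"
    then obtain a b where ab: "v \<noteq> 0\<^sub>v (n * n)" "a \<in> carrier_vec n" "b \<in> carrier_vec n" "v = a \<otimes>\<^sub>v b"
      by (auto simp: product_state_def)
    have "v \<bullet>c s = 0" if s: "s \<in> tile_vecs n" for s
    proof -
      have sc: "s \<in> carrier_vec (n * n)" using s tile_vecs_carrier by blast
      have "normalize_vec s \<in> span_vec (n * n) (GenTiles1 n)"
        using s span_vec_superset[OF S] by (auto simp: GenTiles1_eq)
      then have "v \<bullet>c normalize_vec s = 0"
        using v by (simp add: hermitian_complement_def)
      \<comment> \<open>Positivity makes the normalizing factor nonzero, so orthogonality passes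
        from the normalized state back to \<open>s\<close>.\<close>
      moreover have "Re (s \<bullet>c s) > 0"
        using tile_vecs_product[of h s] s h n by (metis Re_complex_of_real gr0I not_numeral_le_zero)
      moreover have "v \<in> carrier_vec (n * n)" using v by (simp add: hermitian_complement_def)
      ultimately show ?thesis
        using cscalar_normalize_right[OF sc] by auto
    qed
    then have "a = 0\<^sub>v n \<or> b = 0\<^sub>v n"
      using tensor_orthogonal_tile_vecs[OF h] ab n by simp
    moreover have "i div n < n" "i mod n < n" if "i < n * n" for i
      using that assms by (auto simp: less_mult_imp_div_less)
    ultimately have "v = 0\<^sub>v (n * n)"
      using ab by (intro eq_vecI) (auto simp: tensor_vec_def)
    then show False using ab by simp
  qed
  then show ?thesis
    using prod on tile_vecs_span_proper[of h] h
    unfolding unextendible_product_basis_def partial_product_basis_def n by auto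
qed

end
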